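(* Let $X$ be a finite skew brace and let $Y\leq X$ be a subskew brace. Then $Y^n\leq X^n$ for every $n\geq1$. In particular, every subskew brace of a left-nilpotent finite skew brace is left nilpotent, and $$\mathfrak{R}_L(Y)\leq Y\cap\mathfrak{R}_L(X).$$
   Context: A skew (left) brace is a triple $X=(X,+,\cdot)$ such that $(X,+)$ and $(X,\cdot)$ are groups on the same set and $a\cdot(b+c)=a\cdot b-a+a\cdot c$ for all $a,b,c\in X$. A subskew brace is a subset that is a subgroup of both groups. Put $\lambda_a(b)=-a+a\cdot b$ and $a*b=\lambda_a(b)-b$; for subsets $S,T$, $S*T$ is the subgroup of $(X,+)$ generated by all $s*t$, $s\in S$, $t\in T$. An ideal of $X$ is a subgroup of $(X,+)$ that is invariant under every $\lambda_a$ and normal in both $(X,+)$ and $(X,\cdot)$. The left series of a skew brace $X$ is $X^1=X$, $X^{n+1}=X*X^n$ (and $Y^n$ is the left series of $Y$ as a skew brace); $X$ is left nilpotent if $X^n=0$ for some $n$. The left-nilpotent residual $\mathfrak{R}_L(X)$ is the intersection of all ideals $I$ of $X$ such that $X/I$ is left nilpotent. *)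

theory Defs
  imports "HOL-Algebra.AbelCoset" "HOL-Algebra.Generated_Groups"
begin

text \<open>
  The two group structures on one set are stored in a record of type \<^typ>\<open>'a ring\<close>: the record
  itself, read as a monoid, is \<open>(X, \<cdot>)\<close>, and \<open>add_monoid X\<close> is \<open>(X, +)\<close>.  The group \<open>(X, +)\<close> need
  not be abelian, so none of the ring locales applies.
\<close>

locale skew_brace =
  fixes X (structure)
  assumes additive_group: "group (add_monoid X)"
    and multiplicative_group: "group X"
    and brace_distrib:
      "\<lbrakk>a \<in> carrier X; b \<in> carrier X; c \<in> carrier X\<rbrakk>
        \<Longrightarrow> a \<otimes> (b \<oplus> c) = ((a \<otimes> b) \<ominus> a) \<oplus> (a \<otimes> c)"

text \<open>\<open>Y\<close> as a skew brace in its own right is \<open>X\<lparr>carrier := Y\<rparr>\<close>.\<close>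

definition subskew_brace :: "'a set \<Rightarrow> ('a, 'm) ring_scheme \<Rightarrow> bool" where
  "subskew_brace Y X \<longleftrightarrow> subgroup Y (add_monoid X) \<and> subgroup Y X"

definition brace_lambda :: "('a, 'm) ring_scheme \<Rightarrow> 'a \<Rightarrow> 'a \<Rightarrow> 'a" where
  "brace_lambda X a b = (\<ominus>\<^bsub>X\<^esub> a) \<oplus>\<^bsub>X\<^esub> (a \<otimes>\<^bsub>X\<^esub> b)"

definition brace_star :: "('a, 'm) ring_scheme \<Rightarrow> 'a \<Rightarrow> 'a \<Rightarrow> 'a" where
  "brace_star X a b = brace_lambda X a b \<ominus>\<^bsub>X\<^esub> b"

definition set_star :: "('a, 'm) ring_scheme \<Rightarrow> 'a set \<Rightarrow> 'a set \<Rightarrow> 'a set" where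
  "set_star X S T = generate (add_monoid X) {brace_star X s t | s t. s \<in> S \<and> t \<in> T}"

text \<open>The series is indexed from 1; the value at 0 is a dummy.\<close>

fun left_series :: "('a, 'm) ring_scheme \<Rightarrow> nat \<Rightarrow> 'a set" where
  "left_series X 0 = carrier X"
| "left_series X (Suc 0) = carrier X"
| "left_series X (Suc (Suc n)) = set_star X (carrier X) (left_series X (Suc n))"

definition left_nilpotent :: "('a, 'm) ring_scheme \<Rightarrow> bool" where
  "left_nilpotent X \<longleftrightarrow> (\<exists>n\<ge>1. left_series X n = {\<zero>\<^bsub>X\<^esub>})"

definition brace_ideal :: "'a set \<Rightarrow> ('a, 'm) ring_scheme \<Rightarrow> bool" where
  "brace_ideal I X \<longleftrightarrow> I \<lhd> add_monoid X \<and> I \<lhd> X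
     \<and> (\<forall>a\<in>carrier X. \<forall>b\<in>I. brace_lambda X a b \<in> I)"

text \<open>
  For an ideal the additive and the multiplicative cosets coincide, so that both operations of
  \<open>X/I\<close> are element-wise operations on additive cosets (see \<open>skew_brace_quot\<close> below).
\<close>

definition brace_quot :: "('a, 'm) ring_scheme \<Rightarrow> 'a set \<Rightarrow> 'a set ring" where
  "brace_quot X I = \<lparr>carrier = a_rcosets\<^bsub>X\<^esub> I, mult = set_mult X, one = I,
     zero = I, add = set_add X\<rparr>"

definition left_nilpotent_residual :: "('a, 'm) ring_scheme \<Rightarrow> 'a set" where
  "left_nilpotent_residual X = \<Inter>{I. brace_ideal I X \<and> left_nilpotent (brace_quot X I)}"

context skew_brace
begin

sublocale add: group "add_monoid X"
  rewrites "carrier (add_monoid X) = carrier X"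
    and "mult (add_monoid X) = add X"
    and "one (add_monoid X) = zero X"
    and "m_inv (add_monoid X) = a_inv X"
  using additive_group by (simp_all add: a_inv_def)

sublocale mult: group X
  by (rule multiplicative_group)

lemma one_eq_zero: "\<one> = \<zero>"
proof -
  have "\<one> \<oplus> \<zero> = (\<one> \<ominus> \<one>) \<oplus> \<zero>"
    using brace_distrib[of \<one> \<zero> \<zero>] add.l_one[of \<zero>] by (simp add: a_minus_def)
  then show ?thesis by (simp add: a_minus_def)
qed

lemma mult_eq_add_lambda:
  assumes "a \<in> carrier X" "b \<in> carrier X"
  shows "a \<otimes> b = a \<oplus> brace_lambda X a b"
  using assms by (simp add: brace_lambda_def add.m_assoc[symmetric])

lemma lambda_closed:
  "\<lbrakk>a \<in> carrier X; b \<in> carrier X\<rbrakk> \<Longrightarrow> brace_lambda X a b \<in> carrier X"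
  by (simp add: brace_lambda_def)

lemma star_closed:
  "\<lbrakk>a \<in> carrier X; b \<in> carrier X\<rbrakk> \<Longrightarrow> brace_star X a b \<in> carrier X"
  by (simp add: brace_star_def a_minus_def lambda_closed)

lemma lambda_inv:
  assumes "a \<in> carrier X" "b \<in> carrier X"
  shows "brace_lambda X a (brace_lambda X (inv a) b) = b"
proof -
  have [simp]: "(inv a) \<otimes> b \<in> carrier X" "\<ominus> (inv a) \<in> carrier X" using assms by simp_all
  have 1: "a \<otimes> (\<ominus> (inv a)) = a \<oplus> a"
  proof -
    have "\<zero> = inv a \<oplus> \<ominus> (inv a)" using assms by simp
    then have "a \<otimes> \<zero> = (a \<otimes> inv a \<ominus> a) \<oplus> (a \<otimes> (\<ominus> (inv a)))"
      using assms brace_distrib[of a "inv a" "\<ominus> (inv a)"] by simp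
    then have "a = \<ominus> a \<oplus> a \<otimes> (\<ominus> (inv a))"
      using assms one_eq_zero by (metis a_minus_def mult.r_inv mult.r_one add.l_one add.inv_closed)
    then show ?thesis using assms
      by (metis add.inv_solve_left mult.m_closed \<open>\<ominus> (inv a) \<in> carrier X\<close>)
  qed
  have "a \<otimes> brace_lambda X (inv a) b = ((a \<oplus> a) \<ominus> a) \<oplus> (a \<otimes> (inv a \<otimes> b))"
    unfolding brace_lambda_def using assms brace_distrib[of a "\<ominus> (inv a)" "inv a \<otimes> b"] 1 by simp
  also have "\<dots> = a \<oplus> b"
    using assms by (simp add: a_minus_def add.m_assoc mult.m_assoc[symmetric])
  finally show ?thesis using assms by (simp add: brace_lambda_def add.m_assoc[symmetric])
qed

lemma left_series_subgroup: "subgroup (left_series X n) (add_monoid X)"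
proof -
  show ?thesis
  proof (induction n rule: less_induct)
    case (less n)
    consider "n = 0" | "n = Suc 0" | m where "n = Suc (Suc m)" by (metis not0_implies_Suc)
    then show ?case
    proof cases
      case 3
      have "left_series X (Suc m) \<subseteq> carrier X"
        using less[of "Suc m"] 3 subgroup.subset by fastforce
      then have "{brace_star X s t | s t. s \<in> carrier X \<and> t \<in> left_series X (Suc m)}
                   \<subseteq> carrier (add_monoid X)"
        using star_closed by auto
      then show ?thesis unfolding 3 left_series.simps set_star_def
        by (rule group.generate_is_subgroup[OF additive_group])
    qed (use group.subgroup_self[OF additive_group] in auto)
  qed
qed

lemma coset_eq:
  assumes "brace_ideal I X" and a: "a \<in> carrier X"
  shows "I +> a = I #> a"
proof -
  have na: "I \<lhd> add_monoid X" and nm: "I \<lhd> X"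
    and lam: "\<And>a b. a \<in> carrier X \<Longrightarrow> b \<in> I \<Longrightarrow> brace_lambda X a b \<in> I"
    using assms by (auto simp: brace_ideal_def)
  have sub: "I \<subseteq> carrier X"
    using nm by (simp add: normal_def subgroup.subset)
  have "I +> a = {a \<oplus> h | h. h \<in> I}"
    using normal.coset_eq[OF na] a by (auto simp: a_r_coset_def l_coset_def)
  also have "\<dots> = {a \<otimes> h | h. h \<in> I}"
  proof (rule Set.set_eqI, rule iffI)
    fix y assume "y \<in> {a \<oplus> h | h. h \<in> I}"
    then obtain h where h: "h \<in> I" "y = a \<oplus> h" by blast
    let ?k = "brace_lambda X (inv a) h"
    have k: "?k \<in> I" using h a lam by simp
    have "a \<otimes> ?k = y"
      using mult_eq_add_lambda[of a ?k] lambda_inv[of a h] a h subsetD[OF sub h(1)] subsetD[OF sub k]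
      by simp
    with k show "y \<in> {a \<otimes> h | h. h \<in> I}" by blast
  next
    fix y assume "y \<in> {a \<otimes> h | h. h \<in> I}"
    then show "y \<in> {a \<oplus> h | h. h \<in> I}"
      using mult_eq_add_lambda a lam sub by blast
  qed
  also have "\<dots> = I #> a"
    using normal.coset_eq[OF nm] a by (auto simp: l_coset_def)
  finally show ?thesis .
qed

lemma skew_brace_sub:
  assumes "subskew_brace Y X"
  shows "skew_brace (X\<lparr>carrier := Y\<rparr>)"
proof -
  have sa: "subgroup Y (add_monoid X)" and sm: "subgroup Y X"
    using assms by (auto simp: subskew_brace_def)
  have eq: "add_monoid (X\<lparr>carrier := Y\<rparr>) = (add_monoid X)\<lparr>carrier := Y\<rparr>" by simp
  have neg: "a_inv (X\<lparr>carrier := Y\<rparr>) a = \<ominus> a" if "a \<in> Y" for a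
    unfolding a_inv_def eq using group.m_inv_consistent[OF additive_group sa that] .
  show ?thesis
  proof (rule skew_brace.intro)
    show "group (add_monoid (X\<lparr>carrier := Y\<rparr>))"
      unfolding eq by (rule subgroup.subgroup_is_group[OF sa additive_group])
    show "group (X\<lparr>carrier := Y\<rparr>)"
      by (rule subgroup.subgroup_is_group[OF sm multiplicative_group])
  qed (use neg brace_distrib subgroup.subset[OF sm] in \<open>simp add: a_minus_def subset_iff\<close>)
qed

lemma skew_brace_quot:
  assumes I: "brace_ideal I X"
  shows "skew_brace (brace_quot X I)"
proof -
  let ?Q = "brace_quot X I"
  have na: "I \<lhd> add_monoid X" and nm: "I \<lhd> X"
    using I by (auto simp: brace_ideal_def)
  have car: "carrier ?Q = {I +> a | a. a \<in> carrier X}"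
    by (auto simp: brace_quot_def A_RCOSETS_def' )
  have eqa: "add_monoid ?Q = add_monoid X Mod I"
    by (simp add: brace_quot_def FactGroup_def A_RCOSETS_def set_add_def)
  have car': "carrier ?Q = carrier (X Mod I)"
    unfolding car using coset_eq[OF I] by (auto simp: FactGroup_def RCOSETS_def)
  have ga: "group (add_monoid ?Q)"
    unfolding eqa by (rule normal.factorgroup_is_group[OF na])
  have "group (X Mod I)" by (rule normal.factorgroup_is_group[OF nm])
  moreover have "mult ?Q = mult (X Mod I)" "one ?Q = one (X Mod I)"
    by (simp_all add: brace_quot_def)
  ultimately have gm: "group ?Q"
    using car' by (simp add: group_def monoid_def group_axioms_def Units_def)
  have add: "(I +> a) \<oplus>\<^bsub>?Q\<^esub> (I +> b) = I +> (a \<oplus> b)"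
    if "a \<in> carrier X" "b \<in> carrier X" for a b
    using normal.rcos_sum[OF na] that by (simp add: brace_quot_def set_add_def a_r_coset_def)
  have mul: "(I +> a) \<otimes>\<^bsub>?Q\<^esub> (I +> b) = I +> (a \<otimes> b)"
    if "a \<in> carrier X" "b \<in> carrier X" for a b
    using normal.rcos_sum[OF nm] that by (simp add: brace_quot_def coset_eq[OF I])
  have neg: "\<ominus>\<^bsub>?Q\<^esub> (I +> a) = I +> (\<ominus> a)" if a: "a \<in> carrier X" for a
  proof -
    have "I +> a \<in> carrier (add_monoid X Mod I)"
      using a car eqa by (metis (mono_tags, lifting) mem_Collect_eq partial_object.select_convs(1))
    then show ?thesis
      unfolding a_inv_def eqa using normal.inv_FactGroup[OF na] normal.rcos_inv[OF na] a
      by (simp add: a_r_coset_def a_inv_def)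
  qed
  show ?thesis
  proof (rule skew_brace.intro[OF ga gm])
    fix A B C assume "A \<in> carrier ?Q" "B \<in> carrier ?Q" "C \<in> carrier ?Q"
    then obtain a b c where "A = I +> a" "B = I +> b" "C = I +> c"
      and "a \<in> carrier X" "b \<in> carrier X" "c \<in> carrier X" using car by auto
    then show "A \<otimes>\<^bsub>?Q\<^esub> (B \<oplus>\<^bsub>?Q\<^esub> C) = ((A \<otimes>\<^bsub>?Q\<^esub> B) \<ominus>\<^bsub>?Q\<^esub> A) \<oplus>\<^bsub>?Q\<^esub> (A \<otimes>\<^bsub>?Q\<^esub> C)"
      using brace_distrib by (simp add: a_minus_def add mul neg)
  qed
qed

lemma brace_ideal_carrier: "brace_ideal (carrier X) X"
proof -
  have "carrier X \<lhd> X"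
    using group.normal_inv_iff[OF multiplicative_group] group.subgroup_self[OF multiplicative_group]
    by simp
  moreover have "carrier X \<lhd> add_monoid X"
    using group.normal_inv_iff[OF additive_group] group.subgroup_self[OF additive_group]
    by (simp flip: a_inv_def)
  ultimately show ?thesis by (simp add: brace_ideal_def lambda_closed)
qed

lemma left_nilpotent_quot_carrier: "left_nilpotent (brace_quot X (carrier X))"
proof -
  have "carrier (brace_quot X (carrier X)) = {carrier X}"
    using add.coset_join2[of _ "carrier X"] group.subgroup_self[OF additive_group]
    by (auto simp: brace_quot_def A_RCOSETS_def RCOSETS_def)
  then have "left_series (brace_quot X (carrier X)) 1 = {\<zero>\<^bsub>brace_quot X (carrier X)\<^esub>}"
    by (simp add: brace_quot_def)
  then show ?thesis unfolding left_nilpotent_def by blast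
qed

lemma left_nilpotent_residual_subgroup: "subgroup (left_nilpotent_residual X) (add_monoid X)"
  unfolding left_nilpotent_residual_def
proof (rule group.subgroups_Inter[OF additive_group])
  show "{I. brace_ideal I X \<and> left_nilpotent (brace_quot X I)} \<noteq> {}"
    using brace_ideal_carrier left_nilpotent_quot_carrier by blast
qed (auto simp: brace_ideal_def normal_def)

end

end

theory Submission
  imports Defs
begin

text \<open>
  Everything rests on the naturality of the left series: a homomorphism \<open>h\<close> of skew braces satisfies
  \<open>h (a * b) = h a * h b\<close>, and it maps the subgroup generated by a set onto the subgroup generated by
  the image. Hence, by induction, \<open>h\<close> maps \<open>X^n\<close> into \<open>Z^n\<close>, and onto it when \<open>h\<close> is
  surjective (\<open>left_series_image_subset\<close>, \<open>left_series_image_eq\<close>).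

  The inclusion of a subskew brace \<open>Y\<close> gives \<open>Y^n \<subseteq> X^n\<close>. The projection onto \<open>X/I\<close> shows that
  \<open>X/I\<close> is left nilpotent iff some \<open>X^n\<close> lies in \<open>I\<close> (\<open>left_nilpotent_quot_iff\<close>). In that case
  \<open>Y^n \<subseteq> Y \<inter> I\<close>, and \<open>Y \<inter> I\<close> is an ideal of \<open>Y\<close>, so the same criterion makes \<open>Y/(Y \<inter> I)\<close> left
  nilpotent without comparing it to a subskew brace of \<open>X/I\<close>. Every ideal that is intersected in the
  definition of the residual of \<open>X\<close> thus contains one that is intersected for \<open>Y\<close>.
\<close>

locale skew_brace_hom = X: skew_brace X + Z: skew_brace Z
  for X :: "('a, 'm) ring_scheme" (structure) and Z :: "('b, 'k) ring_scheme" (structure) +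
  fixes h :: "'a \<Rightarrow> 'b"
  assumes hom_add: "h \<in> hom (add_monoid X) (add_monoid Z)"
    and hom_mult: "h \<in> hom X Z"
begin

lemma add_group_hom: "group_hom (add_monoid X) (add_monoid Z) h"
  using X.additive_group Z.additive_group hom_add
  by (simp add: group_hom_def group_hom_axioms_def)

lemma hom_minus: "a \<in> carrier X \<Longrightarrow> h (\<ominus>\<^bsub>X\<^esub> a) = \<ominus>\<^bsub>Z\<^esub> (h a)"
  using group_hom.hom_inv[OF add_group_hom] by (simp add: a_inv_def)

lemma hom_star:
  assumes "a \<in> carrier X" "b \<in> carrier X"
  shows "h (brace_star X a b) = brace_star Z (h a) (h b)"
proof -
  have "h (x \<oplus>\<^bsub>X\<^esub> y) = h x \<oplus>\<^bsub>Z\<^esub> h y" if "x \<in> carrier X" "y \<in> carrier X" for x y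
    using hom_mult that group_hom.hom_mult[OF add_group_hom] by simp
  moreover have "h (a \<otimes>\<^bsub>X\<^esub> b) = h a \<otimes>\<^bsub>Z\<^esub> h b"
    using hom_mult assms by (simp add: hom_def)
  ultimately show ?thesis
    using assms by (simp add: brace_star_def brace_lambda_def a_minus_def hom_minus)
qed

lemma set_star_image:
  assumes "S \<subseteq> carrier X" "T \<subseteq> carrier X"
  shows "h ` set_star X S T = set_star Z (h ` S) (h ` T)"
proof -
  let ?K = "{brace_star X s t | s t. s \<in> S \<and> t \<in> T}"
  have "h (brace_star X s t) = brace_star Z (h s) (h t)" if "s \<in> S" "t \<in> T" for s t
    using that assms hom_star by blast
  then have "h ` ?K = {brace_star Z s t | s t. s \<in> h ` S \<and> t \<in> h ` T}"
    by (auto simp: image_iff) metis+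
  moreover have "?K \<subseteq> carrier (add_monoid X)"
    using assms X.star_closed by auto
  ultimately show ?thesis
    unfolding set_star_def using group_hom.generate_img[OF add_group_hom, of ?K] by simp
qed

lemma left_series_subset_carrier: "left_series X n \<subseteq> carrier X"
  using subgroup.subset[OF X.left_series_subgroup] by simp

lemma left_series_image_subset: "h ` left_series X n \<subseteq> left_series Z n"
proof (induction n)
  case 0
  show ?case using hom_mult by (auto simp: hom_def)
next
  case (Suc n)
  have carrier: "h ` carrier X \<subseteq> carrier Z"
    using hom_mult by (auto simp: hom_def)
  then have "set_star Z (h ` carrier X) (h ` left_series X n)
      \<subseteq> set_star Z (carrier Z) (left_series Z n)"
    unfolding set_star_def using Suc
    by (intro group.mono_generate[OF Z.additive_group]) blast
  \<comment> \<open>The recursion \<open>X^(n+1) = X * X^n\<close> starts at \<open>n = 1\<close>; for \<open>n = 0\<close> both values are the carrier.\<close>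
  then show ?case
    using carrier by (cases n) (simp_all add: set_star_image left_series_subset_carrier)
qed

lemma left_series_image_eq:
  assumes "h ` carrier X = carrier Z"
  shows "h ` left_series X n = left_series Z n"
proof (induction n)
  case (Suc n)
  then show ?case
    using assms by (cases n) (simp_all add: set_star_image left_series_subset_carrier)
qed (simp add: assms)

end

lemma (in skew_brace) subskew_brace_inclusion:
  assumes "subskew_brace Y X"
  shows "skew_brace_hom (X\<lparr>carrier := Y\<rparr>) X (\<lambda>x. x)"
proof -
  have "Y \<subseteq> carrier X"
    using assms subgroup.subset by (auto simp: subskew_brace_def)
  then show ?thesis
    using skew_brace_sub[OF assms] skew_brace_axioms
    by (auto simp: skew_brace_hom_def skew_brace_hom_axioms_def hom_def)
qed

lemma (in skew_brace) left_series_subskew_brace: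
  assumes "subskew_brace Y X"
  shows "left_series (X\<lparr>carrier := Y\<rparr>) n \<subseteq> left_series X n"
  using skew_brace_hom.left_series_image_subset[OF subskew_brace_inclusion[OF assms]] by simp

lemma (in skew_brace) left_nilpotent_iff_subset:
  "left_nilpotent X \<longleftrightarrow> (\<exists>n\<ge>1. left_series X n \<subseteq> {\<zero>})"
proof -
  have "\<zero> \<in> left_series X n" for n
    using subgroup.one_closed[OF left_series_subgroup] by simp
  then show ?thesis
    unfolding left_nilpotent_def by blast
qed

lemma (in skew_brace) brace_quot_projection:
  assumes I: "brace_ideal I X"
  shows "skew_brace_hom X (brace_quot X I) (\<lambda>a. I +> a)"
proof -
  have na: "I \<lhd> add_monoid X" and nm: "I \<lhd> X"
    using I by (auto simp: brace_ideal_def)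
  have "add_monoid (brace_quot X I) = add_monoid X Mod I"
    by (simp add: brace_quot_def FactGroup_def A_RCOSETS_def set_add_def)
  then have add: "(\<lambda>a. I +> a) \<in> hom (add_monoid X) (add_monoid (brace_quot X I))"
    using normal.r_coset_hom_Mod[OF na] by (simp add: a_r_coset_def)
  have mult: "(\<lambda>a. I +> a) \<in> hom X (brace_quot X I)"
  proof (rule homI)
    fix a b assume ab: "a \<in> carrier X" "b \<in> carrier X"
    \<comment> \<open>The cosets of an ideal are the same for both operations.\<close>
    then show "I +> (a \<otimes> b) = (I +> a) \<otimes>\<^bsub>brace_quot X I\<^esub> (I +> b)"
      using normal.rcos_sum[OF nm] by (simp add: brace_quot_def coset_eq[OF I])
  next
    fix a assume "a \<in> carrier X"
    then show "I +> a \<in> carrier (brace_quot X I)"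
      by (auto simp: brace_quot_def A_RCOSETS_def')
  qed
  show ?thesis
    using add mult skew_brace_axioms skew_brace_quot[OF I]
    by (simp add: skew_brace_hom_def skew_brace_hom_axioms_def)
qed

text \<open>
  Left nilpotency of \<open>X/I\<close> becomes a condition on the left series of \<open>X\<close> itself, because
  \<open>(X/I)^n\<close> is the image of \<open>X^n\<close> under the projection and \<open>I\<close> is its kernel.
\<close>

lemma (in skew_brace) left_nilpotent_quot_iff:
  assumes I: "brace_ideal I X"
  shows "left_nilpotent (brace_quot X I) \<longleftrightarrow> (\<exists>n\<ge>1. left_series X n \<subseteq> I)"
proof -
  interpret Q: skew_brace_hom X "brace_quot X I" "\<lambda>a. I +> a"
    by (rule brace_quot_projection[OF I])
  have sub: "subgroup I (add_monoid X)"
    using I by (simp add: brace_ideal_def normal_def)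
  have surj: "(\<lambda>a. I +> a) ` carrier X = carrier (brace_quot X I)"
    by (auto simp: brace_quot_def A_RCOSETS_def')
  have kernel: "I +> a = I \<longleftrightarrow> a \<in> I" if "a \<in> carrier X" for a
    using that add.coset_join1[of I a] add.coset_join2[of a I] sub subgroup.subset[OF sub]
    by (auto simp: a_r_coset_def)
  have "left_series (brace_quot X I) n \<subseteq> {\<zero>\<^bsub>brace_quot X I\<^esub>} \<longleftrightarrow> left_series X n \<subseteq> I" for n
  proof -
    have "\<zero>\<^bsub>brace_quot X I\<^esub> = I"
      by (simp add: brace_quot_def)
    then show ?thesis
      using kernel Q.left_series_subset_carrier[of n]
      unfolding Q.left_series_image_eq[OF surj, symmetric] by (auto simp: image_subset_iff subset_iff)
  qed
  then show ?thesis
    by (simp add: Q.Z.left_nilpotent_iff_subset)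
qed

lemma (in skew_brace) brace_ideal_Int_subskew_brace:
  assumes Y: "subskew_brace Y X" and I: "brace_ideal I X"
  shows "brace_ideal (Y \<inter> I) (X\<lparr>carrier := Y\<rparr>)"
proof -
  let ?Y = "X\<lparr>carrier := Y\<rparr>"
  have sa: "subgroup Y (add_monoid X)" and sm: "subgroup Y X"
    using Y by (auto simp: subskew_brace_def)
  have na: "I \<lhd> add_monoid X" and nm: "I \<lhd> X"
    using I by (auto simp: brace_ideal_def)
  have "Y \<inter> I \<lhd> add_monoid ?Y"
    using group.normal_Int_subgroup[OF additive_group sa na] by (simp add: Int_commute)
  moreover have "Y \<inter> I \<lhd> ?Y"
    using group.normal_Int_subgroup[OF multiplicative_group sm nm] by (simp add: Int_commute)
  moreover have "brace_lambda ?Y a b \<in> Y \<inter> I" if ab: "a \<in> Y" "b \<in> Y \<inter> I" for a b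
  proof
    interpret Y: skew_brace ?Y
      by (rule skew_brace_sub[OF Y])
    show "brace_lambda ?Y a b \<in> Y"
      using Y.lambda_closed[of a b] ab by simp
    have "\<ominus>\<^bsub>?Y\<^esub> a = \<ominus> a"
      using skew_brace_hom.hom_minus[OF subskew_brace_inclusion[OF Y]] ab by simp
    then have "brace_lambda ?Y a b = brace_lambda X a b"
      by (simp add: brace_lambda_def)
    then show "brace_lambda ?Y a b \<in> I"
      using I ab subgroup.mem_carrier[OF sm] by (simp add: brace_ideal_def)
  qed
  ultimately show ?thesis
    by (simp add: brace_ideal_def)
qed

lemma (in skew_brace) left_nilpotent_residual_subskew_brace:
  assumes Y: "subskew_brace Y X"
  shows "left_nilpotent_residual (X\<lparr>carrier := Y\<rparr>) \<subseteq> Y \<inter> left_nilpotent_residual X"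
proof -
  let ?Y = "X\<lparr>carrier := Y\<rparr>"
  interpret Y: skew_brace ?Y
    by (rule skew_brace_sub[OF Y])
  have "left_nilpotent_residual ?Y \<subseteq> I"
    if I: "brace_ideal I X" and nil: "left_nilpotent (brace_quot X I)" for I
  proof -
    obtain n where n: "n \<ge> 1" "left_series X n \<subseteq> I"
      using nil left_nilpotent_quot_iff[OF I] by blast
    have "left_series ?Y n \<subseteq> Y \<inter> I"
      using n left_series_subskew_brace[OF Y, of n] subgroup.subset[OF Y.left_series_subgroup, of n]
      by auto
    then have "left_nilpotent (brace_quot ?Y (Y \<inter> I))"
      using n Y.left_nilpotent_quot_iff brace_ideal_Int_subskew_brace[OF Y I] by blast
    then have "left_nilpotent_residual ?Y \<subseteq> Y \<inter> I"
      using brace_ideal_Int_subskew_brace[OF Y I] by (auto simp: left_nilpotent_residual_def)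
    then show ?thesis by blast
  qed
  then have "left_nilpotent_residual ?Y \<subseteq> left_nilpotent_residual X"
    unfolding left_nilpotent_residual_def[of X] by blast
  moreover have "left_nilpotent_residual ?Y \<subseteq> Y"
    using subgroup.subset[OF Y.left_nilpotent_residual_subgroup] by simp
  ultimately show ?thesis by blast
qed

theorem lemma5p7:
  fixes X :: "('a, 'm) ring_scheme" and Y :: "'a set"
  assumes "skew_brace X" and "finite (carrier X)" and "subskew_brace Y X"
  shows "(\<forall>n\<ge>1. left_series (X\<lparr>carrier := Y\<rparr>) n \<subseteq> left_series X n)
    \<and> (left_nilpotent X \<longrightarrow> left_nilpotent (X\<lparr>carrier := Y\<rparr>))
    \<and> left_nilpotent_residual (X\<lparr>carrier := Y\<rparr>) \<subseteq> Y \<inter> left_nilpotent_residual X"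
proof -
  interpret X: skew_brace X by fact
  interpret Y: skew_brace "X\<lparr>carrier := Y\<rparr>"
    by (rule X.skew_brace_sub[OF assms(3)])
  note series = X.left_series_subskew_brace[OF assms(3)]
  have "left_nilpotent X \<longrightarrow> left_nilpotent (X\<lparr>carrier := Y\<rparr>)"
    unfolding X.left_nilpotent_iff_subset Y.left_nilpotent_iff_subset
    using series by fastforce
  then show ?thesis
    using series X.left_nilpotent_residual_subskew_brace[OF assms(3)] by blast
qed

end
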